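(* Let $\langle U,\theta\rangle$ be an approximation space, let $C(R_\theta)$ denote the center of its principal rough set algebra $R_\theta$, and let $E$ be the indexing set for the equivalence classes of $\theta$. Then $C(R_\theta)\cong 2^E$ as a Boolean algebra.
   Context: An approximation space $\langle U,\theta\rangle$ is a nonempty set $U$ with an equivalence relation $\theta$; $\theta_x$ denotes the $\theta$-class of $x$. The indexing set $E$ of the classes is a set in bijection with the set of $\theta$-classes. For $X\subseteq U$, $\overline{X}=\bigcup\{\theta_x:\theta_x\cap X\neq\emptyset\}$ and $\underline{X}=\bigcup\{\theta_x:\theta_x\subseteq X\}$; the pair $\langle\underline{X},\overline{X}\rangle$ is a rough set. $R_\theta$ is the set of all rough sets $\langle\underline{X},\overline{X}\rangle$, $X\subseteq U$. Complements $^c$ are in $U$. The principal rough set algebra, also denoted $R_\theta$, has $0=\langle\emptyset,\emptyset\rangle$, $1=\langle U,U\rangle$, componentwise union as $\vee$, componentwise intersection as $\wedge$, $\langle\underline{X},\overline{X}\rangle^*=\langle\overline{X}^c,\overline{X}^c\rangle$ and $\langle\underline{X},\overline{X}\rangle^+=\langle\underline{X}^c,\underline{X}^c\rangle$. It is a regular double Stone algebra (a bounded distributive lattice with pseudocomplement $^*$ and dual pseudocomplement $^+$ satisfying $x^*\vee x^{**}=1$, $x^+\wedge x^{++}=0$, and $x\wedge x^+\le y\vee y^*$ for all $x,y$). The center of a regular double Stone algebra $L$ is $C(L)=\{x\in L:x^*=x^+\}$, which is a Boolean algebra under the induced $\wedge,\vee$ and $^*$ (as complement). $2^E$ denotes the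 Boolean algebra of all subsets of $E$. *)

theory Defs
  imports Main
begin

record 'a lattice_alg =
  carr :: "'a set"
  meet :: "'a \<Rightarrow> 'a \<Rightarrow> 'a"
  join :: "'a \<Rightarrow> 'a \<Rightarrow> 'a"
  lzero :: 'a
  lone :: 'a

record 'a boolean_alg = "'a lattice_alg" +
  compl :: "'a \<Rightarrow> 'a"

record 'a double_stone_alg = "'a lattice_alg" +
  star :: "'a \<Rightarrow> 'a"
  dstar :: "'a \<Rightarrow> 'a" \<comment> \<open>the dual pseudocomplement, written \<open>x\<^sup>+\<close>\<close>

definition is_boolean_algebra :: "('a, 'm) boolean_alg_scheme \<Rightarrow> bool" where
  "is_boolean_algebra B \<longleftrightarrow>
     lzero B \<in> carr B \<and> lone B \<in> carr B \<and>
     (\<forall>x\<in>carr B. compl B x \<in> carr B) \<and>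
     (\<forall>x\<in>carr B. \<forall>y\<in>carr B. meet B x y \<in> carr B \<and> join B x y \<in> carr B) \<and>
     (\<forall>x\<in>carr B. \<forall>y\<in>carr B. meet B x y = meet B y x \<and> join B x y = join B y x) \<and>
     (\<forall>x\<in>carr B. \<forall>y\<in>carr B. \<forall>z\<in>carr B.
        meet B (meet B x y) z = meet B x (meet B y z) \<and>
        join B (join B x y) z = join B x (join B y z)) \<and>
     (\<forall>x\<in>carr B. \<forall>y\<in>carr B.
        meet B x (join B x y) = x \<and> join B x (meet B x y) = x) \<and>
     (\<forall>x\<in>carr B. \<forall>y\<in>carr B. \<forall>z\<in>carr B.
        meet B x (join B y z) = join B (meet B x y) (meet B x z) \<and>
        join B x (meet B y z) = meet B (join B x y) (join B x z)) \<and>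
     (\<forall>x\<in>carr B. meet B x (lone B) = x \<and> join B x (lzero B) = x) \<and>
     (\<forall>x\<in>carr B. meet B x (compl B x) = lzero B \<and> join B x (compl B x) = lone B)"

definition boolean_hom ::
  "('a, 'm) boolean_alg_scheme \<Rightarrow> ('b, 'n) boolean_alg_scheme \<Rightarrow> ('a \<Rightarrow> 'b) \<Rightarrow> bool" where
  "boolean_hom A B h \<longleftrightarrow>
     h ` carr A \<subseteq> carr B \<and>
     h (lzero A) = lzero B \<and> h (lone A) = lone B \<and>
     (\<forall>x\<in>carr A. h (compl A x) = compl B (h x)) \<and>
     (\<forall>x\<in>carr A. \<forall>y\<in>carr A.
        h (meet A x y) = meet B (h x) (h y) \<and> h (join A x y) = join B (h x) (h y))"

definition boolean_isomorphic ::
  "('a, 'm) boolean_alg_scheme \<Rightarrow> ('b, 'n) boolean_alg_scheme \<Rightarrow> bool" where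
  "boolean_isomorphic A B \<longleftrightarrow>
     is_boolean_algebra A \<and> is_boolean_algebra B \<and>
     (\<exists>h. boolean_hom A B h \<and> bij_betw h (carr A) (carr B))"

definition powerset_algebra :: "'e set \<Rightarrow> 'e set boolean_alg" where
  "powerset_algebra E =
     \<lparr>carr = Pow E, meet = (\<inter>), join = (\<union>), lzero = {}, lone = E, compl = (\<lambda>A. E - A)\<rparr>"

definition center :: "('a, 'm) double_stone_alg_scheme \<Rightarrow> 'a boolean_alg" where
  "center L =
     \<lparr>carr = {x \<in> carr L. star L x = dstar L x}, meet = meet L, join = join L,
      lzero = lzero L, lone = lone L, compl = star L\<rparr>"

definition approximation_space :: "'a set \<Rightarrow> ('a \<times> 'a) set \<Rightarrow> bool" where
  "approximation_space U \<theta> \<longleftrightarrow> U \<noteq> {} \<and> equiv U \<theta>"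

definition upper_approx :: "'a set \<Rightarrow> ('a \<times> 'a) set \<Rightarrow> 'a set \<Rightarrow> 'a set" where
  "upper_approx U \<theta> X = \<Union> {\<theta> `` {x} |x. x \<in> U \<and> \<theta> `` {x} \<inter> X \<noteq> {}}"

definition lower_approx :: "'a set \<Rightarrow> ('a \<times> 'a) set \<Rightarrow> 'a set \<Rightarrow> 'a set" where
  "lower_approx U \<theta> X = \<Union> {\<theta> `` {x} |x. x \<in> U \<and> \<theta> `` {x} \<subseteq> X}"

definition rough_set :: "'a set \<Rightarrow> ('a \<times> 'a) set \<Rightarrow> 'a set \<Rightarrow> 'a set \<times> 'a set" where
  "rough_set U \<theta> X = (lower_approx U \<theta> X, upper_approx U \<theta> X)"

definition rough_set_algebra ::
  "'a set \<Rightarrow> ('a \<times> 'a) set \<Rightarrow> ('a set \<times> 'a set) double_stone_alg" where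
  "rough_set_algebra U \<theta> =
     \<lparr>carr = {rough_set U \<theta> X |X. X \<subseteq> U},
      meet = (\<lambda>p q. (fst p \<inter> fst q, snd p \<inter> snd q)),
      join = (\<lambda>p q. (fst p \<union> fst q, snd p \<union> snd q)),
      lzero = ({}, {}),
      lone = (U, U),
      star = (\<lambda>p. (U - snd p, U - snd p)),
      dstar = (\<lambda>p. (U - fst p, U - fst p))\<rparr>"

end

(* A rough set is central iff its two components agree, i.e. iff it is (S, S) for a union S of
   classes. Choosing a representative r e of each class cls e, a union of classes S corresponds to
   the set of indices e with r e \<in> S; membership in S of single points visibly commutes with
   the Boolean operations. *)
theory Submission
  imports Defs
begin

text \<open>By symmetry and transitivity, a class meeting \<open>X\<close> consists exactly of the
  points related to some element of \<open>X\<close>.\<close>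

lemma upper_approx_eq_Image:
  assumes "equiv U \<theta>" "X \<subseteq> U"
  shows "upper_approx U \<theta> X = \<theta> `` X"
proof -
  have "sym \<theta>" "refl_on U \<theta>" "trans \<theta>" "\<theta> \<subseteq> U \<times> U"
    using assms(1) by (auto elim: equivE)
  then show ?thesis
    using assms(2) unfolding upper_approx_def refl_on_def
    by (blast dest: symD transD)
qed

lemma lower_approx_eq:
  assumes "equiv U \<theta>"
  shows "lower_approx U \<theta> X = {x \<in> U. \<theta> `` {x} \<subseteq> X}"
proof -
  have "sym \<theta>" "refl_on U \<theta>" "trans \<theta>" "\<theta> \<subseteq> U \<times> U"
    using assms by (auto elim: equivE)
  then show ?thesis
    unfolding lower_approx_def refl_on_def
    by (blast dest: symD transD)
qed

text \<open>Reflexivity squeezes \<open>X\<close> between its lower and upper approximations.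
  Centrality makes their complements in \<open>U\<close> agree, so both equal \<open>X\<close>. The
  closure condition on \<open>S\<close> says that \<open>S\<close> is a union of classes; such a set
  is its own lower and upper approximation.\<close>

lemma carr_center_rough_set_algebra:
  assumes "equiv U \<theta>"
  shows "carr (center (rough_set_algebra U \<theta>)) = {(S, S) |S. S \<subseteq> U \<and> \<theta> `` S \<subseteq> S}"
    (is "?C = ?D")
proof -
  have eqv: "sym \<theta>" "refl_on U \<theta>" "trans \<theta>" "\<theta> \<subseteq> U \<times> U"
    using assms by (auto elim: equivE)
  have C: "?C = {rough_set U \<theta> X |X. X \<subseteq> U \<and> U - upper_approx U \<theta> X = U - lower_approx U \<theta> X}"
    by (auto simp: center_def rough_set_algebra_def rough_set_def)
  have eq: "rough_set U \<theta> X = (X, X) \<and> \<theta> `` X \<subseteq> X"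
    if "X \<subseteq> U" "U - upper_approx U \<theta> X = U - lower_approx U \<theta> X" for X
  proof -
    have "lower_approx U \<theta> X \<subseteq> X" "X \<subseteq> upper_approx U \<theta> X" "upper_approx U \<theta> X \<subseteq> U"
      using that(1) eqv unfolding lower_approx_eq[OF assms] upper_approx_eq_Image[OF assms that(1)]
        refl_on_def by blast+
    moreover from this that have "lower_approx U \<theta> X = upper_approx U \<theta> X"
      by blast
    ultimately show ?thesis
      using upper_approx_eq_Image[OF assms that(1)] by (auto simp: rough_set_def)
  qed
  have "rough_set U \<theta> S = (S, S) \<and> U - upper_approx U \<theta> S = U - lower_approx U \<theta> S"
    if "S \<subseteq> U" "\<theta> `` S \<subseteq> S" for S
  proof -
    have "lower_approx U \<theta> S = S" "upper_approx U \<theta> S = S"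
      using that eqv unfolding lower_approx_eq[OF assms] upper_approx_eq_Image[OF assms that(1)]
        refl_on_def by blast+
    then show ?thesis
      by (simp add: rough_set_def)
  qed
  then have "?D \<subseteq> ?C"
    unfolding C by clarsimp metis
  moreover have "?C \<subseteq> ?D"
    unfolding C by clarify (metis eq)
  ultimately show ?thesis
    by blast
qed

lemma is_boolean_algebra_center_rough_set_algebra:
  assumes "equiv U \<theta>"
  shows "is_boolean_algebra (center (rough_set_algebra U \<theta>))"
proof -
  have "sym \<theta>" "\<theta> \<subseteq> U \<times> U"
    using assms by (auto elim: equivE)
  \<comment> \<open>Only closure under complement needs symmetry: a point outside \<open>S\<close>
    related to a point of \<open>S\<close> would itself lie in the image of
    \<open>S\<close>.\<close>
  then have "\<theta> `` (U - S) \<subseteq> U - S" if "\<theta> `` S \<subseteq> S" for S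
    using that by (blast dest: symD)
  moreover have "\<theta> `` U \<subseteq> U"
    using \<open>\<theta> \<subseteq> U \<times> U\<close> by blast
  ultimately show ?thesis
    unfolding is_boolean_algebra_def carr_center_rough_set_algebra[OF assms]
    by (simp add: center_def rough_set_algebra_def) blast
qed

lemma is_boolean_algebra_powerset_algebra: "is_boolean_algebra (powerset_algebra E)"
  unfolding is_boolean_algebra_def powerset_algebra_def by auto

theorem proposition2:
  fixes U :: "'a set" and \<theta> :: "('a \<times> 'a) set"
    and E :: "'e set" and cls :: "'e \<Rightarrow> 'a set"
  assumes "approximation_space U \<theta>"
    and "bij_betw cls E (U // \<theta>)"
  shows "boolean_isomorphic (center (rough_set_algebra U \<theta>)) (powerset_algebra E)"
proof -
  have equiv: "equiv U \<theta>"
    using assms(1) by (simp add: approximation_space_def)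
  then have eqv: "sym \<theta>" "refl_on U \<theta>" "trans \<theta>" "\<theta> \<subseteq> U \<times> U"
    by (auto elim: equivE)
  note carr = carr_center_rough_set_algebra[OF equiv]
  have "\<exists>x\<in>U. cls e = \<theta> `` {x}" if "e \<in> E" for e
    using bij_betwE[OF assms(2)] that by (metis quotientE)
  then obtain r where r: "\<And>e. e \<in> E \<Longrightarrow> r e \<in> U \<and> cls e = \<theta> `` {r e}"
    by metis
  \<comment> \<open>Surjectivity of \<open>cls\<close> puts every point in the class of some
    representative; its injectivity, used in \<open>distinct\<close>, leaves only one per
    class.\<close>
  have cover: "\<exists>e\<in>E. (r e, x) \<in> \<theta>" if "x \<in> U" for x
  proof -
    have "\<theta> `` {x} \<in> cls ` E"
      using that assms(2) by (simp add: bij_betw_def quotientI)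
    then obtain e where "e \<in> E" "\<theta> `` {x} = \<theta> `` {r e}"
      using r by auto
    then show ?thesis
      using that eqv(2) unfolding refl_on_def by blast
  qed
  have distinct: "e = e'" if "e \<in> E" "e' \<in> E" "(r e, r e') \<in> \<theta>" for e e'
    using that r equiv_class_eq[OF equiv that(3)] assms(2)
    by (metis bij_betw_def inj_onD)
  \<comment> \<open>Reading only \<open>fst\<close> is harmless on diagonal pairs, and this is why
    \<open>h\<close> respects the complement, which is computed from \<open>snd\<close>.\<close>
  define h where "h p = {e \<in> E. r e \<in> fst p}" for p :: "'a set \<times> 'a set"
  have "boolean_hom (center (rough_set_algebra U \<theta>)) (powerset_algebra E) h"
    unfolding boolean_hom_def carr
    using r by (auto simp: center_def rough_set_algebra_def powerset_algebra_def h_def)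
  moreover have "bij_betw h {(S, S) |S. S \<subseteq> U \<and> \<theta> `` S \<subseteq> S} (Pow E)"
    unfolding bij_betw_def
  proof
    \<comment> \<open>Membership passes from \<open>x\<close> in \<open>S\<close> to its
      representative by symmetry, then to \<open>T\<close> by equality of the index sets, then back
      to \<open>x\<close>. Exchanging \<open>S\<close> and \<open>T\<close> gives
      injectivity.\<close>
    have sub: "S \<subseteq> T" if "S \<subseteq> U" "\<theta> `` S \<subseteq> S" "\<theta> `` T \<subseteq> T" "h (S, S) = h (T, T)" for S T
    proof
      fix x assume "x \<in> S"
      with that(1) have "x \<in> U"
        by blast
      then obtain e where e: "e \<in> E" "(r e, x) \<in> \<theta>"
        using cover by blast
      then have "r e \<in> S"
        using \<open>x \<in> S\<close> that(2) eqv(1) by (blast dest: symD)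
      then have "r e \<in> T"
        using e that(4) by (auto simp: h_def)
      then show "x \<in> T"
        using e that(3) by blast
    qed
    show "inj_on h {(S, S) |S. S \<subseteq> U \<and> \<theta> `` S \<subseteq> S}"
      by (rule inj_onI, clarify) (metis sub subset_antisym)
    have "F \<in> h ` {(S, S) |S. S \<subseteq> U \<and> \<theta> `` S \<subseteq> S}" if "F \<subseteq> E" for F
    proof -
      \<comment> \<open>The preimage of \<open>F\<close> is the union of the classes indexed by
        \<open>F\<close>. By \<open>distinct\<close> it contains no representative with index
        outside \<open>F\<close>, and by reflexivity it contains all those with index in
        \<open>F\<close>.\<close>
      define S where "S = \<theta> `` r ` F"
      have "S \<subseteq> U" "\<theta> `` S \<subseteq> S"
        using eqv unfolding S_def by (blast dest: transD)+
      moreover have "h (S, S) = F"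
      proof
        show "h (S, S) \<subseteq> F"
          using distinct that unfolding h_def S_def by auto
        show "F \<subseteq> h (S, S)"
          using r that eqv(2) unfolding h_def S_def refl_on_def by fastforce
      qed
      ultimately show ?thesis
        by (intro image_eqI[of _ _ "(S, S)"]) auto
    qed
    then show "h ` {(S, S) |S. S \<subseteq> U \<and> \<theta> `` S \<subseteq> S} = Pow E"
      by (auto simp: h_def)
  qed
  ultimately show ?thesis
    unfolding boolean_isomorphic_def
    using is_boolean_algebra_center_rough_set_algebra[OF equiv]
      is_boolean_algebra_powerset_algebra carr
    by (auto simp: powerset_algebra_def)
qed

end
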